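(* Let $m$ be a positive integer and $n = 4m-1$. Then $p_n \ge 2 - \frac{1}{3\cdot 2^{m-1}-1}$. Equivalently: there exist real numbers $a_1,\dots,a_n\in[0,1]$ such that for every choice of signs $e_1,\dots,e_n\in\{-1,+1\}$, with $s_0=0$ and $s_i=\sum_{k=1}^i e_k a_k$ for $1\le i\le n$, we have $\max_{0\le k\le n} s_k - \min_{0\le k\le n} s_k \ge 2 - \frac{1}{3\cdot 2^{m-1}-1}$.
   Context: For a positive integer $n$, signs $e_1,\dots,e_n\in\{-1,+1\}$ and reals $a_1,\dots,a_n\in[0,1]$, set $s_0=0$ and $s_i=\sum_{k=1}^i e_k a_k$ for $1\le i\le n$. The range is $g(e_1,\dots,e_n,a_1,\dots,a_n)=\max_{0\le k\le n}s_k-\min_{0\le k\le n}s_k$. The step-cover is $f(a_1,\dots,a_n)=\min_{e_1,\dots,e_n\in\{-1,+1\}} g(e_1,\dots,e_n,a_1,\dots,a_n)$. The fit is $p_n=\max_{a_1,\dots,a_n\in[0,1]} f(a_1,\dots,a_n)$. *)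

theory Defs
  imports "HOL-Analysis.Analysis"
begin

text \<open>
  Finite sequences \<open>x\<^sub>1, \<dots>, x\<^sub>n\<close> are functions \<^typ>\<open>nat \<Rightarrow> real\<close> of which only the
  values on \<open>{1..n}\<close> matter.
\<close>

definition partial_sum :: "(nat \<Rightarrow> real) \<Rightarrow> (nat \<Rightarrow> real) \<Rightarrow> nat \<Rightarrow> real" where
  "partial_sum e a i = (\<Sum>k = 1..i. e k * a k)"

definition walk_range :: "nat \<Rightarrow> (nat \<Rightarrow> real) \<Rightarrow> (nat \<Rightarrow> real) \<Rightarrow> real" where
  "walk_range n e a = Max (partial_sum e a ` {0..n}) - Min (partial_sum e a ` {0..n})"

text \<open>The extensional function space keeps the set of sign vectors finite, as \<^const>\<open>Min\<close> needs.\<close>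

definition step_cover :: "nat \<Rightarrow> (nat \<Rightarrow> real) \<Rightarrow> real" where
  "step_cover n a = Min ((\<lambda>e. walk_range n e a) ` ({1..n} \<rightarrow>\<^sub>E {-1, 1}))"

text \<open>
  \<^const>\<open>Max\<close> is only meaningful on finite sets, hence the supremum;
  lemma \<open>fit_attained\<close> shows that it is a maximum.
\<close>

definition fit :: "nat \<Rightarrow> real" where
  "fit n = (SUP a \<in> {1..n} \<rightarrow>\<^sub>E {0..1}. step_cover n a)"

lemma continuous_on_Max_image:
  fixes F :: "'i \<Rightarrow> 'a::topological_space \<Rightarrow> real"
  assumes "finite I" "I \<noteq> {}" "\<And>i. i \<in> I \<Longrightarrow> continuous_on S (F i)"
  shows "continuous_on S (\<lambda>x. Max ((\<lambda>i. F i x) ` I))"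
  using assms
proof (induction I rule: finite_ne_induct)
  case (insert j I)
  then have "continuous_on S (\<lambda>x. max (F j x) (Max ((\<lambda>i. F i x) ` I)))"
    by (intro continuous_on_max) auto
  with insert show ?case by simp
qed simp

lemma continuous_on_Min_image:
  fixes F :: "'i \<Rightarrow> 'a::topological_space \<Rightarrow> real"
  assumes "finite I" "I \<noteq> {}" "\<And>i. i \<in> I \<Longrightarrow> continuous_on S (F i)"
  shows "continuous_on S (\<lambda>x. Min ((\<lambda>i. F i x) ` I))"
  using assms
proof (induction I rule: finite_ne_induct)
  case (insert j I)
  then have "continuous_on S (\<lambda>x. min (F j x) (Min ((\<lambda>i. F i x) ` I)))"
    by (intro continuous_on_min) auto
  with insert show ?case by simp
qed simp

lemma continuous_on_step_cover: "continuous_on S (step_cover n)"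
proof -
  have ps: "continuous_on S (\<lambda>a. partial_sum e a k)" for e k
    unfolding partial_sum_def
    by (intro continuous_intros continuous_on_subset[OF continuous_on_product_coordinates]) auto
  have "continuous_on S (walk_range n e)" for e
    unfolding walk_range_def
    by (intro continuous_on_diff continuous_on_Max_image continuous_on_Min_image ps) auto
  then show ?thesis
    unfolding step_cover_def
    by (intro continuous_on_Min_image) (auto intro!: finite_PiE simp: PiE_eq_empty_iff)
qed

lemma compact_unit_cube: "compact ({1..n} \<rightarrow>\<^sub>E {0..1::real})"
proof -
  have "{1..n} \<rightarrow>\<^sub>E {0..1::real} = Pi\<^sub>E UNIV (\<lambda>i. if i \<in> {1..n} then {0..1} else {undefined})"
    (is "_ = ?P")
    by (auto simp: PiE_iff extensional_def split: if_splits) 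
  moreover have "compactin (product_topology (\<lambda>_. euclidean) UNIV) ?P"
    unfolding compactin_PiE by auto
  ultimately show ?thesis
    by (simp add: euclidean_product_topology)
qed

lemma fit_attained: "\<exists>a \<in> {1..n} \<rightarrow>\<^sub>E {0..1}. fit n = step_cover n a"
proof -
  have "{1..n} \<rightarrow>\<^sub>E {0..1::real} \<noteq> {}"
    by (auto simp: PiE_eq_empty_iff)
  then obtain a where a: "a \<in> {1..n} \<rightarrow>\<^sub>E {0..1}"
      and le: "\<And>b. b \<in> {1..n} \<rightarrow>\<^sub>E {0..1} \<Longrightarrow> step_cover n b \<le> step_cover n a"
    using continuous_attains_sup[OF compact_unit_cube _ continuous_on_step_cover] by metis
  have "fit n = step_cover n a"
    unfolding fit_def using a le by (intro cSup_eq_maximum) auto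
  with a show ?thesis by blast
qed

end

theory Submission
  imports Defs
begin

text \<open>
  Centred at the midpoint of its range, a walk of range less than \<open>2 - 2 c\<close> stays in \<open>\<bar>x\<bar> < 1 - c\<close>,
  so every step long enough to leave this interval outwards goes towards the origin. A step of
  length \<open>1\<close> thus replaces \<open>\<bar>x\<bar>\<close> by \<open>1 - \<bar>x\<bar>\<close>, which requires \<open>c < \<bar>x\<bar>\<close>, and a subsequent step of length
  \<open>1 - b\<close> turns this into \<open>\<bar>\<bar>x\<bar> - b\<bar>\<close>, provided that \<open>\<bar>x\<bar> \<le> 1 - b + c\<close>. Alternate full steps with steps
  \<open>1 - b\<close>, where \<open>b\<close> is doubled from \<open>2 c\<close> until \<open>3 b = 1 + 2 c\<close> and then halved back to \<open>2 c\<close>. While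
  \<open>b\<close> is doubled, \<open>\<bar>x\<bar> < 1 - b + c\<close> persists, for \<open>\<bar>\<bar>x\<bar> - b\<bar> < 1 - 2 b + c\<close>. At the peak,
  \<open>1 - 2 b + c = b - c\<close>, and while \<open>b\<close> is halved, \<open>\<bar>x\<bar> < 2 b - c\<close> gives \<open>\<bar>\<bar>x\<bar> - b\<bar> < b - c\<close>. In the
  end \<open>\<bar>x\<bar> < c\<close>, and the last full step leaves the interval. The peak is reached after \<open>m - 1\<close>
  doublings if \<open>2 c = 1 / (3 \<cdot> 2 ^ (m - 1) - 1)\<close>.
\<close>

definition is_walk :: "nat \<Rightarrow> (nat \<Rightarrow> real) \<Rightarrow> (nat \<Rightarrow> real) \<Rightarrow> bool" where
  "is_walk n a x \<longleftrightarrow> (\<forall>k<n. \<bar>x (Suc k) - x k\<bar> = \<bar>a (Suc k)\<bar>)"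

definition midrange :: "nat \<Rightarrow> (nat \<Rightarrow> real) \<Rightarrow> (nat \<Rightarrow> real) \<Rightarrow> real" where
  "midrange n e a = (Max (partial_sum e a ` {0..n}) + Min (partial_sum e a ` {0..n})) / 2"

lemma abs_partial_sum_minus_midrange_le:
  assumes "k \<le> n"
  shows "\<bar>partial_sum e a k - midrange n e a\<bar> \<le> walk_range n e a / 2"
proof -
  have "partial_sum e a k \<le> Max (partial_sum e a ` {0..n})"
    and "Min (partial_sum e a ` {0..n}) \<le> partial_sum e a k"
    using assms by auto
  then show ?thesis
    unfolding walk_range_def midrange_def by (simp add: abs_le_iff field_simps)
qed

lemma is_walk_partial_sum_minus:
  assumes "\<forall>i \<in> {1..n}. e i \<in> {-1, 1}"
  shows "is_walk n a (\<lambda>k. partial_sum e a k - z)"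
  unfolding is_walk_def
proof (intro allI impI)
  fix k assume "k < n"
  then have "e (Suc k) \<in> {-1, 1}"
    using assms by simp
  then show "\<bar>(partial_sum e a (Suc k) - z) - (partial_sum e a k - z)\<bar> = \<bar>a (Suc k)\<bar>"
    by (auto simp: partial_sum_def)
qed

lemma walk_range_ge_if_walks_escape:
  assumes "\<forall>i \<in> {1..n}. e i \<in> {-1, 1}"
    and escape: "\<And>x. is_walk n a x \<Longrightarrow> \<exists>k\<le>n. r \<le> \<bar>x k\<bar>"
  shows "2 * r \<le> walk_range n e a"
proof -
  obtain k where "k \<le> n" and "r \<le> \<bar>partial_sum e a k - midrange n e a\<bar>"
    using escape[OF is_walk_partial_sum_minus] assms(1) by blast
  with abs_partial_sum_minus_midrange_le[OF \<open>k \<le> n\<close>, of e a] show ?thesis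
    by linarith
qed

lemma walk_range_cong:
  assumes "\<And>k. k \<in> {1..n} \<Longrightarrow> e k * a k = e' k * a' k"
  shows "walk_range n e a = walk_range n e' a'"
proof -
  have "partial_sum e a ` {0..n} = partial_sum e' a' ` {0..n}"
    unfolding partial_sum_def using assms by (intro image_cong sum.cong) auto
  then show ?thesis
    unfolding walk_range_def by simp
qed

lemma step_cover_ge:
  assumes "\<And>e. \<forall>i \<in> {1..n}. e i \<in> {-1, 1} \<Longrightarrow> v \<le> walk_range n e a"
  shows "v \<le> step_cover n a"
  unfolding step_cover_def using assms
  by (subst Min_ge_iff) (auto intro!: finite_PiE simp: PiE_eq_empty_iff PiE_iff)

lemma step_cover_le_fit:
  assumes "a \<in> {1..n} \<rightarrow>\<^sub>E {0..1}"
  shows "step_cover n a \<le> fit n"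
  unfolding fit_def using assms
  by (intro cSUP_upper bounded_imp_bdd_above compact_imp_bounded
      compact_continuous_image continuous_on_step_cover compact_unit_cube)

lemma fit_ge:
  assumes "\<forall>i \<in> {1..n}. a i \<in> {0..1}"
    and range_ge: "\<And>e. \<forall>i \<in> {1..n}. e i \<in> {-1, 1} \<Longrightarrow> v \<le> walk_range n e a"
  shows "v \<le> fit n"
proof -
  have "walk_range n e (restrict a {1..n}) = walk_range n e a" for e
    by (intro walk_range_cong) simp
  then have "v \<le> step_cover n (restrict a {1..n})"
    by (intro step_cover_ge) (simp add: range_ge)
  also have "\<dots> \<le> fit n"
    using assms(1) by (intro step_cover_le_fit) (simp add: PiE_iff)
  finally show ?thesis .
qed

locale folded_sequence =
  fixes y b :: "nat \<Rightarrow> real" and c :: real and q :: nat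
  assumes y_gt: "j \<le> q \<Longrightarrow> c < y j"
    and fold_eq: "j \<le> q \<Longrightarrow> y j \<le> 1 - b j + c \<Longrightarrow> y (Suc j) = \<bar>y j - b j\<bar>"
    and b_le: "j \<le> q \<Longrightarrow> 3 * b j \<le> 1 + 2 * c"
begin

lemma less_while_at_most_doubling:
  assumes "y 0 < 1 - b 0 + c" and "\<And>i. i < j \<Longrightarrow> b (Suc i) \<le> 2 * b i" and "j \<le> q"
  shows "y j < 1 - b j + c"
  using assms
proof (induction j)
  case (Suc j)
  then have "y j < 1 - b j + c"
    by simp
  then have "y (Suc j) < 1 - 2 * b j + c"
    using Suc.prems(3) fold_eq[of j] y_gt[of j] b_le[of j] by auto
  then show ?case
    using Suc.prems(2)[of j] by simp
qed simp

lemma less_while_at_most_halving: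
  assumes start: "y p < 1 - b p + c" and peak: "1 + 2 * c \<le> 3 * b p"
    and halving: "\<And>i. p \<le> i \<Longrightarrow> i < j \<Longrightarrow> b i \<le> 2 * b (Suc i)" and "p \<le> j" and "j \<le> q"
  shows "y (Suc j) < b j - c"
  using \<open>p \<le> j\<close> halving \<open>j \<le> q\<close>
proof (induction j rule: dec_induct)
  case base
  then show ?case
    using peak start fold_eq[of p] y_gt[of p] by auto
next
  case (step i)
  have "y (Suc i) < b i - c"
    using step.prems by (intro step.IH) auto
  also have "b i \<le> 2 * b (Suc i)"
    using step.hyps(1) by (intro step.prems(1)) auto
  finally have "y (Suc i) < 2 * b (Suc i) - c"
    by simp
  then show ?case
    using step.prems(2) fold_eq[of "Suc i"] y_gt[of "Suc i"] b_le[of "Suc i"] by auto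
qed

end

lemma abs_after_inward_step:
  fixes x y :: "'a :: linordered_idom"
  assumes "\<bar>y - x\<bar> = d" and "\<bar>y\<bar> < r" and "r \<le> \<bar>x\<bar> + d"
  shows "\<bar>y\<bar> = \<bar>\<bar>x\<bar> - d\<bar>"
  using assms by linarith

lemma abs_after_full_and_shortened_step:
  fixes x y z :: "'a :: linordered_idom"
  assumes "0 \<le> c" and "\<bar>y - x\<bar> = 1" and "\<bar>z - y\<bar> = 1 - b"
    and "\<bar>x\<bar> < 1 - c" and "\<bar>y\<bar> < 1 - c" and "\<bar>z\<bar> < 1 - c" and "\<bar>x\<bar> \<le> 1 - b + c"
  shows "\<bar>z\<bar> = \<bar>\<bar>x\<bar> - b\<bar>"
proof -
  have "\<bar>y\<bar> = \<bar>\<bar>x\<bar> - 1\<bar>"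
    using assms by (intro abs_after_inward_step[where r = "1 - c"]) auto
  then have y: "\<bar>y\<bar> = 1 - \<bar>x\<bar>"
    using assms by linarith
  then have "\<bar>z\<bar> = \<bar>\<bar>y\<bar> - (1 - b)\<bar>"
    using assms by (intro abs_after_inward_step[where r = "1 - c"]) auto
  then show ?thesis
    unfolding y by linarith
qed

text \<open>Only indices \<open>i \<ge> 1\<close> matter: the steps are \<open>1, 1 - b 0, 1, 1 - b 1, 1, \<dots>\<close>.\<close>

definition alternating_steps :: "(nat \<Rightarrow> real) \<Rightarrow> nat \<Rightarrow> real" where
  "alternating_steps b i = (if odd i then 1 else 1 - b (i div 2 - 1))"

lemma alternating_steps_mem_unit_interval:
  assumes "\<And>j. b j \<in> {0..1}"
  shows "alternating_steps b i \<in> {0..1}"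
  using assms[of "i div 2 - 1"] by (simp add: alternating_steps_def)

lemma is_walk_alternating_steps_full:
  assumes "is_walk n (alternating_steps b) x" and "2 * j < n"
  shows "\<bar>x (2 * j + 1) - x (2 * j)\<bar> = 1"
  using assms by (simp add: is_walk_def alternating_steps_def)

lemma is_walk_alternating_steps_shortened:
  assumes "is_walk n (alternating_steps b) x" and "2 * j + 1 < n"
  shows "\<bar>x (2 * j + 2) - x (2 * j + 1)\<bar> = \<bar>1 - b j\<bar>"
  using assms by (simp add: is_walk_def alternating_steps_def)

lemma folded_sequence_confined_walk:
  assumes walk: "is_walk (2 * q + 2) (alternating_steps b) x" and "0 \<le> c"
    and confined: "\<And>k. k \<le> 2 * q + 2 \<Longrightarrow> \<bar>x k\<bar> < 1 - c"
    and b_le: "\<And>j. j \<le> q \<Longrightarrow> 3 * b j \<le> 1 + 2 * c"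
  shows "folded_sequence (\<lambda>j. \<bar>x (2 * j)\<bar>) b c q"
proof
  fix j assume j: "j \<le> q"
  have full: "\<bar>x (2 * j + 1) - x (2 * j)\<bar> = 1"
    using is_walk_alternating_steps_full[OF walk] j by simp
  then show "c < \<bar>x (2 * j)\<bar>"
    using confined[of "2 * j + 1"] j by linarith
  have "b j \<le> 1"
    using confined[of 0] b_le[OF j] by linarith
  then have "\<bar>x (2 * j + 2) - x (2 * j + 1)\<bar> = 1 - b j"
    using is_walk_alternating_steps_shortened[OF walk] j by simp
  moreover assume "\<bar>x (2 * j)\<bar> \<le> 1 - b j + c"
  ultimately have "\<bar>x (2 * j + 2)\<bar> = \<bar>\<bar>x (2 * j)\<bar> - b j\<bar>"
    using full j \<open>0 \<le> c\<close>
    by (intro abs_after_full_and_shortened_step[of c "x (2 * j + 1)"] confined) auto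
  then show "\<bar>x (2 * Suc j)\<bar> = \<bar>\<bar>x (2 * j)\<bar> - b j\<bar>"
    by simp
qed (fact b_le)

lemma alternating_walk_escapes:
  assumes walk: "is_walk (2 * q + 3) (alternating_steps b) x" and "0 \<le> c" and "p \<le> q"
    and ends: "b 0 \<le> 2 * c" "b q \<le> 2 * c"
    and doubling: "\<And>j. j < p \<Longrightarrow> b (Suc j) \<le> 2 * b j"
    and halving: "\<And>j. p \<le> j \<Longrightarrow> j < q \<Longrightarrow> b j \<le> 2 * b (Suc j)"
    and b_le: "\<And>j. j \<le> q \<Longrightarrow> 3 * b j \<le> 1 + 2 * c" and peak: "1 + 2 * c \<le> 3 * b p"
  shows "\<exists>k\<le>2 * q + 3. 1 - c \<le> \<bar>x k\<bar>"
proof (rule ccontr)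
  assume "\<not> ?thesis"
  then have confined: "\<bar>x k\<bar> < 1 - c" if "k \<le> 2 * q + 3" for k
    using that by (metis not_le)
  interpret folded_sequence "\<lambda>j. \<bar>x (2 * j)\<bar>" b c q
  proof (rule folded_sequence_confined_walk)
    show "is_walk (2 * q + 2) (alternating_steps b) x"
      using walk by (simp add: is_walk_def)
    show "\<bar>x k\<bar> < 1 - c" if "k \<le> 2 * q + 2" for k
      using that by (intro confined) simp
  qed (simp_all add: \<open>0 \<le> c\<close> b_le)
  have "\<bar>x (2 * 0)\<bar> < 1 - b 0 + c"
    using confined[of 0] ends(1) by simp
  then have "\<bar>x (2 * p)\<bar> < 1 - b p + c"
    using doubling \<open>p \<le> q\<close> by (rule less_while_at_most_doubling)
  then have "\<bar>x (2 * Suc q)\<bar> < b q - c"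
    using peak halving \<open>p \<le> q\<close> by (rule less_while_at_most_halving) simp_all
  then have "\<bar>x (2 * Suc q)\<bar> < c"
    using ends(2) by simp
  moreover have "\<bar>x (2 * Suc q + 1) - x (2 * Suc q)\<bar> = 1"
    using is_walk_alternating_steps_full[OF walk, of "Suc q"] by simp
  moreover have "\<bar>x (2 * Suc q + 1)\<bar> < 1 - c"
    by (intro confined) simp
  ultimately show False
    by linarith
qed

definition gap :: "nat \<Rightarrow> real" where
  "gap m = 1 / (3 * 2 ^ (m - 1) - 1)"

text \<open>For \<open>j = 0, \<dots>, 2 m - 2\<close> the values are \<open>gap m\<close> times \<open>1, 2, 4, \<dots>, 2 ^ (m - 1), \<dots>, 4, 2, 1\<close>.\<close>

definition shortening :: "nat \<Rightarrow> nat \<Rightarrow> real" where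
  "shortening m j = 2 ^ min j (2 * m - 2 - j) * gap m"

lemma gap_pos: "0 < gap m"
  and gap_le_half: "gap m \<le> 1 / 2"
proof -
  define D :: real where "D = 3 * 2 ^ (m - 1) - 1"
  have "D \<ge> 2"
    by (simp add: D_def)
  then show "0 < gap m" "gap m \<le> 1 / 2"
    unfolding gap_def D_def[symmetric] by (simp_all add: field_simps)
qed

lemma three_times_power_gap: "3 * (2 ^ (m - 1) * gap m) = 1 + gap m"
proof -
  have "3 * 2 ^ (m - 1) - 1 \<noteq> (0::real)"
    using gap_pos[of m] by (auto simp: gap_def)
  then show ?thesis
    by (simp add: gap_def field_simps)
qed

lemma shortening_nonneg: "0 \<le> shortening m j"
  using gap_pos[of m] by (simp add: shortening_def)

lemma shortening_first: "shortening m 0 = gap m"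
  by (simp add: shortening_def)

lemma shortening_last: "shortening m (2 * m - 2) = gap m"
  by (simp add: shortening_def)

lemma shortening_peak: "3 * shortening m (m - 1) = 1 + gap m"
proof -
  have "min (m - 1) (2 * m - 2 - (m - 1)) = m - 1"
    by simp
  then show ?thesis
    using three_times_power_gap[of m] by (simp add: shortening_def)
qed

lemma three_times_shortening_le: "3 * shortening m j \<le> 1 + gap m"
proof -
  have "(2::real) ^ min j (2 * m - 2 - j) \<le> 2 ^ (m - 1)"
    by (intro power_increasing) auto
  then show ?thesis
    using gap_pos[of m]
    unfolding shortening_def three_times_power_gap[of m, symmetric] by simp
qed

lemma power_times_gap_le_double:
  assumes "k \<le> Suc l"
  shows "2 ^ k * gap m \<le> 2 * (2 ^ l * gap m)"
proof -
  have "(2::real) ^ k \<le> 2 ^ Suc l"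
    using assms by (intro power_increasing) auto
  then show ?thesis
    using gap_pos[of m] by simp
qed

lemma shortening_Suc_le_double: "shortening m (Suc j) \<le> 2 * shortening m j"
  unfolding shortening_def by (rule power_times_gap_le_double) simp

lemma shortening_le_double_Suc: "shortening m j \<le> 2 * shortening m (Suc j)"
  unfolding shortening_def by (rule power_times_gap_le_double) simp

lemma shortened_steps_mem_unit_interval: "alternating_steps (shortening m) i \<in> {0..1}"
proof (rule alternating_steps_mem_unit_interval)
  show "shortening m j \<in> {0..1}" for j
    using shortening_nonneg[of m j] three_times_shortening_le[of m j] gap_le_half[of m] by simp
qed

lemma shortened_walk_escapes:
  assumes "m \<ge> 1" and "is_walk (4 * m - 1) (alternating_steps (shortening m)) x"
  shows "\<exists>k\<le>4 * m - 1. 1 - gap m / 2 \<le> \<bar>x k\<bar>"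
proof -
  have n: "4 * m - 1 = 2 * (2 * m - 2) + 3"
    using assms(1) by simp
  show ?thesis
    unfolding n
  proof (rule alternating_walk_escapes)
    show "is_walk (2 * (2 * m - 2) + 3) (alternating_steps (shortening m)) x"
      using assms(2) unfolding n .
    show "0 \<le> gap m / 2"
      using gap_pos[of m] by simp
    show "shortening m 0 \<le> 2 * (gap m / 2)" "shortening m (2 * m - 2) \<le> 2 * (gap m / 2)"
      by (simp_all add: shortening_first shortening_last)
    show "3 * shortening m j \<le> 1 + 2 * (gap m / 2)" for j
      using three_times_shortening_le[of m j] by simp
    show "1 + 2 * (gap m / 2) \<le> 3 * shortening m (m - 1)"
      using shortening_peak[of m] by simp
  qed (simp_all add: shortening_Suc_le_double shortening_le_double_Suc)
qed

theorem theorem2: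
  fixes m n :: nat
  assumes "m \<ge> 1" and "n = 4 * m - 1"
  shows "fit n \<ge> 2 - 1 / (3 * 2 ^ (m - 1) - 1) \<and>
    (\<exists>a :: nat \<Rightarrow> real. (\<forall>i \<in> {1..n}. a i \<in> {0..1}) \<and>
       (\<forall>e :: nat \<Rightarrow> real. (\<forall>i \<in> {1..n}. e i \<in> {-1, 1}) \<longrightarrow>
          walk_range n e a \<ge> 2 - 1 / (3 * 2 ^ (m - 1) - 1)))"
proof -
  let ?a = "alternating_steps (shortening m)"
  have steps_mem: "\<forall>i \<in> {1..n}. ?a i \<in> {0..1}"
    by (intro ballI shortened_steps_mem_unit_interval)
  have range_ge: "2 - gap m \<le> walk_range n e ?a" if "\<forall>i \<in> {1..n}. e i \<in> {-1, 1}" for e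
    using walk_range_ge_if_walks_escape[OF that, of ?a "1 - gap m / 2"] shortened_walk_escapes assms
    by simp
  have "2 - gap m \<le> fit n"
    using steps_mem range_ge by (rule fit_ge)
  with steps_mem range_ge show ?thesis
    unfolding gap_def by blast
qed

end
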